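(* Let $p\ge 1$ be an integer and let $w=h+\overline{g}$ be a sense-preserving harmonic mapping of $\mathbb{D}$ (with $h,g$ analytic in $\mathbb{D}$) such that $\mu(0,w)=p$ and $w(\mathbb{D})\subset\mathbb{D}$. Put $a_p=\frac{D^p h(0)}{p!}$ and $b_p=\frac{D^p g(0)}{p!}$. If $w$ is differentiable at $z=1$ with $w(1)=1$, then $$\mathrm{Re}\left[w_z(1)+w_{\bar z}(1)\right]\ \ge\ \frac{2}{\pi}\,\frac{(p+1)+\frac{\pi}{4}(p-1)(|a_p|+|b_p|)}{1+\frac{\pi}{4}(|a_p|+|b_p|)}.$$
   Context: $\mathbb{D}=\{z\in\mathbb{C}:|z|<1\}$. $D^k$ denotes the $k$-th order derivative with respect to $z$. A complex-valued $w\in C^2(\mathbb{D})$ is harmonic if $4w_{z\bar z}=0$ in $\mathbb{D}$; then $w=h+\overline{g}$ with $h,g$ analytic in $\mathbb{D}$, unique up to additive constants. Its second complex dilatation is $\omega=\overline{w_{\bar z}}/w_z=g'/h'$. The mapping $w$ is sense-preserving if $h'\not\equiv 0$ and $\omega$ (after removing removable singularities at zeros of $h'$) is analytic in $\mathbb{D}$ with $|\omega(z)|<1$ for all $z\in\mathbb{D}$; zeros of the Jacobian at isolated points are allowed. Multiplicity: let $w=h+\overline g$ be sense-preserving harmonic with $w(z_0)=0$, the additive constants being chosen so that $h(z_0)=g(z_0)=0$. Write $h(z)=\sum_{k\ge n}a_k(z-z_0)^k$ and $g(z)=\sum_{k\ge m}b_k(z-z_0)^k$ near $z_0$ with $a_n\ne0$,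 $b_m\neq 0$ ($m=\infty$ if $g\equiv0$). Then, since $|\omega(z_0)|<1$, either $n<m$, or $m=n$ and $|b_n|<|a_n|$. One says $w$ has a zero of order $n$ at $z_0$ and writes $\mu(z_0,w)=n$. Differentiability at the boundary point $1$ with $w(1)=1$ means that $w$ is extended to $\mathbb{D}\cup\{1\}$ by $w(1)=1$ and there are complex numbers $w_z(1),w_{\bar z}(1)$ with $w(z)=1+w_z(1)(z-1)+w_{\bar z}(1)(\bar z-1)+o(|z-1|)$ as $z\to1$, $z\in\mathbb{D}$. *)

theory Defs
  imports "HOL-Complex_Analysis.Complex_Analysis"
begin

text \<open>
  The Wirtinger operators \<open>(\<partial>\<^sub>x - i \<partial>\<^sub>y)/2\<close> and \<open>(\<partial>\<^sub>x + i \<partial>\<^sub>y)/2\<close>; \<open>frechet_derivative\<close> is the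
  real derivative, so its values at \<open>1\<close> and \<open>\<i>\<close> are the two partial derivatives.
\<close>

definition wirtinger_z :: "(complex \<Rightarrow> complex) \<Rightarrow> complex \<Rightarrow> complex" where
  "wirtinger_z w z =
     (frechet_derivative w (at z) 1 - \<i> * frechet_derivative w (at z) \<i>) / 2"

definition wirtinger_zbar :: "(complex \<Rightarrow> complex) \<Rightarrow> complex \<Rightarrow> complex" where
  "wirtinger_zbar w z =
     (frechet_derivative w (at z) 1 + \<i> * frechet_derivative w (at z) \<i>) / 2"

text \<open>
  \<open>C\<^sup>2\<close> in the real sense, for open \<open>S\<close>.  Continuity of the first-order derivatives is implied by
  their differentiability.
\<close>

definition C2_on :: "(complex \<Rightarrow> complex) \<Rightarrow> complex set \<Rightarrow> bool" where
  "C2_on w S \<longleftrightarrow>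
     w differentiable_on S \<and>
     wirtinger_z w differentiable_on S \<and>
     wirtinger_zbar w differentiable_on S \<and>
     continuous_on S (wirtinger_z (wirtinger_z w)) \<and>
     continuous_on S (wirtinger_zbar (wirtinger_z w)) \<and>
     continuous_on S (wirtinger_z (wirtinger_zbar w)) \<and>
     continuous_on S (wirtinger_zbar (wirtinger_zbar w))"

definition harmonic_map_on :: "(complex \<Rightarrow> complex) \<Rightarrow> complex set \<Rightarrow> bool" where
  "harmonic_map_on w S \<longleftrightarrow>
     C2_on w S \<and> (\<forall>z\<in>S. 4 * wirtinger_zbar (wirtinger_z w) z = 0)"

definition second_dilatation :: "(complex \<Rightarrow> complex) \<Rightarrow> complex \<Rightarrow> complex" where
  "second_dilatation w z = cnj (wirtinger_zbar w z) / wirtinger_z w z"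

text \<open>
  The function \<open>\<omega>\<close> is the dilatation with its removable singularities at the zeros of
  \<open>w\<^sub>z = h'\<close> removed; the values of \<open>second_dilatation\<close> at those zeros are ignored.
\<close>

definition sense_preserving_on :: "(complex \<Rightarrow> complex) \<Rightarrow> complex set \<Rightarrow> bool" where
  "sense_preserving_on w S \<longleftrightarrow>
     (\<exists>z\<in>S. wirtinger_z w z \<noteq> 0) \<and>
     (\<exists>\<omega>. \<omega> holomorphic_on S \<and>
          (\<forall>z\<in>S. wirtinger_z w z \<noteq> 0 \<longrightarrow> \<omega> z = second_dilatation w z) \<and>
          (\<forall>z\<in>S. norm (\<omega> z) < 1))"

definition harmonic_decomposition ::
  "(complex \<Rightarrow> complex) \<Rightarrow> (complex \<Rightarrow> complex) \<Rightarrow> (complex \<Rightarrow> complex) \<Rightarrow> complex set \<Rightarrow> bool" where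
  "harmonic_decomposition w h g S \<longleftrightarrow>
     h holomorphic_on S \<and> g holomorphic_on S \<and> (\<forall>z\<in>S. w z = h z + cnj (g z))"

text \<open>
  \<open>harmonic_zero_order w S z\<^sub>0 n\<close> says \<open>\<mu>(z\<^sub>0, w) = n\<close> for a sense-preserving harmonic \<open>w\<close> on \<open>S\<close>:
  with the additive constants normalised so that both parts vanish at \<open>z\<^sub>0\<close>, the first nonzero
  Taylor coefficient of the analytic part at \<open>z\<^sub>0\<close> is the \<open>n\<close>-th.  Nothing is required of the
  coefficients of \<open>g\<close>: that they vanish below \<open>n\<close>, and that the \<open>n\<close>-th one is smaller in modulus
  than that of \<open>h\<close>, is a consequence of \<open>w\<close> being sense-preserving.
\<close>

definition harmonic_zero_order ::
  "(complex \<Rightarrow> complex) \<Rightarrow> complex set \<Rightarrow> complex \<Rightarrow> nat \<Rightarrow> bool" where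
  "harmonic_zero_order w S z\<^sub>0 n \<longleftrightarrow>
     w z\<^sub>0 = 0 \<and>
     (\<exists>h g. harmonic_decomposition w h g S \<and> h z\<^sub>0 = 0 \<and> g z\<^sub>0 = 0 \<and>
        (\<forall>k<n. (deriv ^^ k) h z\<^sub>0 / fact k = 0) \<and> (deriv ^^ n) h z\<^sub>0 / fact n \<noteq> 0)"

text \<open>
  Real differentiability at a boundary point, where \<open>A\<close> and \<open>B\<close> are the derivatives of \<open>w\<close>
  with respect to \<open>z\<close> and \<open>cnj z\<close> at \<open>\<zeta>\<close>:
  \<open>w(z) = w(\<zeta>) + A (z - \<zeta>) + B cnj (z - \<zeta>) + o(|z - \<zeta>|)\<close> as \<open>z \<rightarrow> \<zeta>\<close> in \<open>S\<close>.
\<close>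

definition has_boundary_wirtinger ::
  "(complex \<Rightarrow> complex) \<Rightarrow> complex \<Rightarrow> complex \<Rightarrow> complex set \<Rightarrow> complex \<Rightarrow> bool" where
  "has_boundary_wirtinger w A B S \<zeta> \<longleftrightarrow>
     (w has_derivative (\<lambda>t. A * t + B * cnj t)) (at \<zeta> within S)"

lemma wirtinger_of_has_derivative:
  assumes "(w has_derivative (\<lambda>t. A * t + B * cnj t)) (at z)"
  shows "wirtinger_z w z = A" "wirtinger_zbar w z = B"
proof -
  have "frechet_derivative w (at z) = (\<lambda>t. A * t + B * cnj t)"
    using frechet_derivative_at[OF assms] by simp
  then show "wirtinger_z w z = A" "wirtinger_zbar w z = B"
    by (simp_all add: wirtinger_z_def wirtinger_zbar_def algebra_simps)
qed

lemma harmonic_decomposition_has_derivative: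
  assumes "harmonic_decomposition w h g S" "open S" "z \<in> S"
  shows "(w has_derivative (\<lambda>t. deriv h z * t + cnj (deriv g z) * cnj t)) (at z)"
proof -
  have h: "(h has_derivative (\<lambda>t. deriv h z * t)) (at z)"
    and g: "(g has_derivative (\<lambda>t. deriv g z * t)) (at z)"
    using assms
    by (auto simp: harmonic_decomposition_def has_field_derivative_def[symmetric]
             intro: holomorphic_derivI)
  have "((\<lambda>z. h z + cnj (g z)) has_derivative
           (\<lambda>t. deriv h z * t + cnj (deriv g z * t))) (at z)"
    by (intro has_derivative_add h has_derivative_cnj g)
  then have "((\<lambda>z. h z + cnj (g z)) has_derivative
           (\<lambda>t. deriv h z * t + cnj (deriv g z) * cnj t)) (at z)"
    by simp
  then show ?thesis
    by (rule has_derivative_transform_within_open[OF _ assms(2,3)])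
       (use assms(1) in \<open>simp add: harmonic_decomposition_def\<close>)
qed

lemma harmonic_decomposition_wirtinger:
  assumes "harmonic_decomposition w h g S" "open S" "z \<in> S"
  shows "wirtinger_z w z = deriv h z" "wirtinger_zbar w z = cnj (deriv g z)"
  using wirtinger_of_has_derivative[OF harmonic_decomposition_has_derivative[OF assms]] by auto

lemma harmonic_decomposition_imp_harmonic:
  assumes "harmonic_decomposition w h g S" "open S"
  shows "harmonic_map_on w S"
proof -
  note hg = assms(1)[unfolded harmonic_decomposition_def]
  have 0: "(\<lambda>_. 0::complex) holomorphic_on S" by simp
  have 1: "harmonic_decomposition (wirtinger_z w) (deriv h) (\<lambda>_. 0) S"
    using harmonic_decomposition_wirtinger[OF assms] hg assms(2)
    by (auto simp: harmonic_decomposition_def intro: holomorphic_deriv)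
  have 2: "harmonic_decomposition (wirtinger_zbar w) (\<lambda>_. 0) (deriv g) S"
    using harmonic_decomposition_wirtinger[OF assms] hg assms(2)
    by (auto simp: harmonic_decomposition_def intro: holomorphic_deriv)
  have d: "u differentiable_on S" if "harmonic_decomposition u a b S" for u a b
    unfolding differentiable_on_def
    using harmonic_decomposition_has_derivative[OF that assms(2)]
    by (blast intro: differentiableI differentiable_at_withinI)
  have ch: "continuous_on S (deriv (deriv h))" and cg: "continuous_on S (\<lambda>z. cnj (deriv (deriv g) z))"
    using hg assms(2)
    by (auto intro!: holomorphic_on_imp_continuous_on holomorphic_deriv continuous_on_cnj)
  have c1: "continuous_on S (wirtinger_z (wirtinger_z w))"
    using ch harmonic_decomposition_wirtinger(1)[OF 1 assms(2)]
    by (simp cong: continuous_on_cong)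
  have c2: "continuous_on S (wirtinger_zbar (wirtinger_zbar w))"
    using cg harmonic_decomposition_wirtinger(2)[OF 2 assms(2)]
    by (simp cong: continuous_on_cong)
  have z1: "wirtinger_zbar (wirtinger_z w) z = 0" if "z \<in> S" for z
    using harmonic_decomposition_wirtinger(2)[OF 1 assms(2) that] by simp
  have z2: "wirtinger_z (wirtinger_zbar w) z = 0" if "z \<in> S" for z
    using harmonic_decomposition_wirtinger(1)[OF 2 assms(2) that] by simp
  show ?thesis
    unfolding harmonic_map_on_def C2_on_def
    using d[OF assms(1)] d[OF 1] d[OF 2] c1 c2 z1 z2
    by (simp cong: continuous_on_cong)
qed

end

theory Submission
  imports Defs
begin

text \<open>
  The real part of \<open>w = h + cnj g\<close> is also the real part of the holomorphic function \<open>h + g\<close>. Since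
  only the real part of \<open>A + B\<close> is to be estimated, this one direction suffices, and the problem
  becomes a boundary Schwarz lemma for a holomorphic map of the disc into the strip
  \<open>\<bar>Re z\<bar> < 1\<close>.

  Subtract the constant \<open>h 0 + g 0\<close>, which is imaginary because \<open>w 0 = 0\<close>, and call the result \<open>F\<close>.
  Sense preservation makes \<open>deriv g\<close> a holomorphic multiple of \<open>deriv h\<close>
  (\<open>sense_preserving_dilatation\<close>), so \<open>g\<close> up to its constant vanishes at \<open>0\<close> at least to the order of
  \<open>h\<close>, and \<open>F z = z ^ p * f z\<close> with \<open>f 0 = a + b\<close>
  (\<open>sum_higher_derivs_zero\<close>, \<open>holomorphic_factor_power\<close>).

  The function \<open>z \<mapsto> tan (pi / 4 * z)\<close> maps the strip onto the disc, has derivative \<open>pi / 4\<close> at \<open>0\<close>,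
  and \<open>tan (Re z) \<le> norm (tan z)\<close> for \<open>\<bar>Re z\<bar> < pi / 4\<close>. So \<open>tan (pi / 4 * F z)\<close> is
  \<open>z ^ p\<close> times a function that is bounded by \<open>1\<close> and has the value \<open>pi / 4 * (a + b)\<close> at \<open>0\<close>.
  The Schwarz--Pick estimate for that function gives, with \<open>c = pi / 4 * (norm a + norm b)\<close>
  and \<open>0 < r < 1\<close>,
  \<open>tan (pi / 4 * Re (w r)) \<le> r ^ p * (r + c) / (1 + c * r)\<close>
  (\<open>tan_Re_growth\<close>).

  Both sides are equal to \<open>1\<close> at \<open>r = 1\<close>, so their left derivatives there are ordered the other way:
  that of the left side is \<open>pi / 2 * Re (A + B)\<close>, that of the right side is
  \<open>((p + 1) + (p - 1) * c) / (1 + c)\<close>, and the claimed bound results.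
\<close>

section \<open>Growth of holomorphic functions on the disc\<close>

text \<open>
  On the circle of radius \<open>r\<close> the assumption says \<open>norm (f z) \<le> 1 / r ^ n\<close>; the maximum principle
  carries this bound inside, and then \<open>r\<close> tends to \<open>1\<close>. Applied to a function with a zero of order
  \<open>n\<close> this is the Schwarz lemma of that order.
\<close>

lemma bounded_by_one_of_power_mult:
  assumes hol: "f holomorphic_on ball 0 1"
    and bound: "\<And>z. norm z < 1 \<Longrightarrow> norm (z ^ n * f z) \<le> 1"
    and z: "norm z < 1"
  shows "norm (f z) \<le> 1"
proof -
  have 1: "norm (f z) \<le> 1 / r ^ n" if r: "norm z < r" "r < 1" for r
  proof (rule maximum_modulus_frontier[of f "cball 0 r"])
    have sub: "cball 0 r \<subseteq> ball (0::complex) 1"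
      using r by auto
    show "f holomorphic_on interior (cball 0 r)"
      using hol sub interior_subset by (meson holomorphic_on_subset order_trans)
    show "continuous_on (closure (cball 0 r)) f"
      using holomorphic_on_imp_continuous_on[OF holomorphic_on_subset[OF hol sub]] by simp
    show "norm (f x) \<le> 1 / r ^ n" if "x \<in> frontier (cball 0 r)" for x
    proof -
      have "r > 0" using r norm_ge_zero[of z] by linarith
      moreover have "norm x = r" using that \<open>r > 0\<close> by (simp add: frontier_cball)
      ultimately show ?thesis
        using bound[of x] r by (simp add: norm_mult norm_power field_simps)
    qed
  qed (use r in auto)
  have "((\<lambda>r. 1 / r ^ n) \<longlongrightarrow> 1 / 1 ^ n) (at_left (1::real))"
    by (intro tendsto_intros) auto
  moreover have "\<forall>\<^sub>F r in at_left 1. norm (f z) \<le> 1 / r ^ n"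
    using eventually_at_left_real[OF z] by eventually_elim (use 1 in auto)
  ultimately show ?thesis
    using tendsto_lowerbound[of "\<lambda>r. 1 / r ^ n"] by fastforce
qed

text \<open>
  Among the points \<open>w\<close> of a given modulus, the pseudohyperbolic distance to \<open>\<alpha>\<close> is least when \<open>w\<close>
  lies on the ray through \<open>\<alpha>\<close>. The reason is the identity
  \<open>1 - norm (m w)\<^sup>2 = (1 - norm \<alpha>\<^sup>2) * (1 - norm w\<^sup>2) / norm (1 - cnj \<alpha> * w)\<^sup>2\<close>
  for the Moebius function \<open>m\<close> that sends \<open>\<alpha>\<close> to \<open>0\<close>, in which the
  denominator is least on that ray.
\<close>

lemma moebius_norm_lower_bound:
  fixes w \<alpha> :: complex
  assumes "norm w < 1" "norm \<alpha> < 1"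
  shows "(norm w - norm \<alpha>) / (1 - norm \<alpha> * norm w) \<le> norm (Moebius_function 0 \<alpha> w)"
proof -
  define s c where "s = norm w" and "c = norm \<alpha>"
  define d where "d = norm (1 - cnj \<alpha> * w)"
  have s: "0 \<le> s" "s < 1" "0 \<le> c" "c < 1" using assms by (auto simp: s_def c_def)
  have cs: "c * s < 1"
    using s by (metis mult_le_one mult_less_cancel_left2 less_eq_real_def linorder_not_le mult_zero_left)
  have "norm (cnj \<alpha> * w) = c * s" by (simp add: norm_mult c_def s_def)
  then have d: "1 - c * s \<le> d"
    unfolding d_def using norm_triangle_ineq2[of 1 "cnj \<alpha> * w"] by simp
  have key: "norm (w - \<alpha>) ^ 2 = d ^ 2 - (1 - c ^ 2) * (1 - s ^ 2)"
    unfolding d_def c_def s_def cmod_power2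
    by (simp add: algebra_simps power2_eq_square)
  have "((s - c) / (1 - c * s)) ^ 2 = 1 - (1 - c ^ 2) * (1 - s ^ 2) / (1 - c * s) ^ 2"
  proof -
    have "(s - c) ^ 2 = (1 - c * s) ^ 2 - (1 - c ^ 2) * (1 - s ^ 2)"
      by (simp add: algebra_simps power2_eq_square)
    then have "((s - c) / (1 - c * s)) ^ 2 =
        ((1 - c * s) ^ 2 - (1 - c ^ 2) * (1 - s ^ 2)) / (1 - c * s) ^ 2"
      by (simp only: power_divide)
    then show ?thesis using cs by (simp only: diff_divide_distrib[of "(1 - c * s) ^ 2"]) simp
  qed
  also have "\<dots> \<le> 1 - (1 - c ^ 2) * (1 - s ^ 2) / d ^ 2"
  proof -
    have "(1 - c ^ 2) * (1 - s ^ 2) \<ge> 0"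
      using s by (simp add: power_le_one)
    moreover have "(1 - c * s) ^ 2 \<le> d ^ 2" "(1 - c * s) ^ 2 > 0"
      using d cs by (auto intro!: power_mono)
    ultimately show ?thesis
      by (smt (verit) frac_le)
  qed
  also have "\<dots> = (norm (w - \<alpha>) / d) ^ 2"
    using key d cs by (simp add: power_divide field_simps)
  also have "norm (w - \<alpha>) / d = norm (Moebius_function 0 \<alpha> w)"
    by (simp add: Moebius_function_simple norm_divide d_def)
  finally show ?thesis
    unfolding s_def c_def by (rule power2_le_imp_le) simp
qed

text \<open>
  Move \<open>f 0\<close> to \<open>0\<close> by a Moebius function, apply the Schwarz lemma, and solve the resulting bound for
  \<open>norm (f z)\<close>. The weak bound in the hypothesis admits a unimodular value only when \<open>f\<close> is
  constant, and then the right-hand side is \<open>1\<close>.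
\<close>

lemma schwarz_pick_growth:
  assumes hol: "f holomorphic_on ball 0 1"
    and bound: "\<And>z. norm z < 1 \<Longrightarrow> norm (f z) \<le> 1"
    and z: "norm z < 1"
  shows "norm (f z) \<le> (norm z + norm (f 0)) / (1 + norm (f 0) * norm z)"
proof (cases "norm (f 0) = 1")
  case True
  then show ?thesis using bound[OF z] by (simp add: add.commute add_nonneg_eq_0_iff)
next
  case False
  define c where "c = norm (f 0)"
  have c: "c < 1" "0 \<le> c" using False bound[of 0] by (auto simp: c_def)
  have strict: "norm (f x) < 1" if x: "norm x < 1" for x
  proof (rule ccontr)
    assume "\<not> norm (f x) < 1"
    then have "norm (f y) \<le> norm (f x)" if "y \<in> ball 0 1" for y
      using bound[of y] that by simp
    then have "f constant_on ball 0 1"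
      using maximum_modulus_principle[OF hol _ _ _ _, of "ball 0 1" x] x by auto
    then have "f x = f 0" using x unfolding constant_on_def by (metis centre_in_ball mem_ball_0 zero_less_one)
    then show False using c \<open>\<not> norm (f x) < 1\<close> by (simp add: c_def)
  qed
  let ?m = "Moebius_function 0 (f 0)"
  have "norm (?m (f z)) \<le> norm z"
  proof (rule Schwarz_Lemma(1)[where f = "\<lambda>z. ?m (f z)"])
    show "(\<lambda>z. ?m (f z)) holomorphic_on ball 0 1"
      using holomorphic_on_compose_gen[OF hol Moebius_function_holomorphic, of "f 0" 0] strict
      by (fastforce simp: o_def)
  qed (use strict z Moebius_function_norm_lt_1 Moebius_function_eq_zero in auto)
  then have "(norm (f z) - c) / (1 - c * norm (f z)) \<le> norm z"
    using moebius_norm_lower_bound[OF strict[OF z] strict[of 0]] by (simp add: c_def)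
  moreover have "c * norm (f z) < 1"
    using strict[OF z] c
    by (metis mult_le_one mult_less_cancel_left2 less_eq_real_def linorder_not_le mult_zero_left norm_ge_zero)
  ultimately have "norm (f z) * (1 + c * norm z) \<le> norm z + c"
    by (simp add: divide_simps algebra_simps split: if_splits)
  moreover have "1 + c * norm z > 0" using c by (smt (verit) mult_nonneg_nonneg norm_ge_zero)
  ultimately show ?thesis
    by (simp add: pos_le_divide_eq c_def)
qed

section \<open>Taylor coefficients\<close>

lemma higher_deriv_ident_mult:
  fixes f :: "complex \<Rightarrow> complex"
  assumes "f holomorphic_on S" "open S" "0 \<in> S"
  shows "(deriv ^^ Suc k) (\<lambda>z. z * f z) 0 = of_nat (Suc k) * (deriv ^^ k) f 0"
proof -
  have "(deriv ^^ Suc k) (\<lambda>z. z * f z) 0 =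
      (\<Sum>i = 0..Suc k. of_nat (Suc k choose i) * (deriv ^^ i) (\<lambda>z. z) 0 * (deriv ^^ (Suc k - i)) f 0)"
    by (rule higher_deriv_mult[OF _ assms]) simp
  also have "\<dots> = (\<Sum>i \<in> {1}. of_nat (Suc k choose i) * (deriv ^^ i) (\<lambda>z. z) 0 * (deriv ^^ (Suc k - i)) f 0)"
    by (rule sum.mono_neutral_right) auto
  finally show ?thesis by simp
qed

lemma holomorphic_factor_power:
  assumes "f holomorphic_on S" "open S" "0 \<in> S"
    and "\<And>k. k < n \<Longrightarrow> (deriv ^^ k) f 0 = 0"
  shows "\<exists>g. g holomorphic_on S \<and> (\<forall>z\<in>S. f z = z ^ n * g z) \<and> g 0 = (deriv ^^ n) f 0 / fact n"
  using assms(1,4)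
proof (induction n arbitrary: f)
  case 0
  then show ?case by (intro exI[of _ f]) auto
next
  case (Suc n)
  define f1 where "f1 = (\<lambda>z. if z = 0 then deriv f 0 else (f z - f 0) / (z - 0))"
  have f0: "f 0 = 0" using Suc.prems(2)[of 0] by simp
  have hol1: "f1 holomorphic_on S"
    unfolding f1_def by (rule pole_lemma_open[OF Suc.prems(1) assms(2)])
  have eq: "f = (\<lambda>z. z * f1 z)" by (auto simp: f1_def f0)
  have der: "(deriv ^^ Suc k) f 0 = of_nat (Suc k) * (deriv ^^ k) f1 0" for k
    using higher_deriv_ident_mult[OF hol1 assms(2,3)] eq by metis
  \<comment> \<open>so the Taylor coefficients of \<open>f1\<close> are those of \<open>f\<close>, shifted by one place\<close>
  have "(deriv ^^ k) f1 0 = 0" if "k < n" for k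
    using der[of k] Suc.prems(2)[of "Suc k"] that by (simp del: funpow.simps of_nat_Suc)
  then obtain g where g: "g holomorphic_on S" "\<forall>z\<in>S. f1 z = z ^ n * g z"
      "g 0 = (deriv ^^ n) f1 0 / fact n"
    using Suc.IH[OF hol1] by blast
  have "g 0 = (deriv ^^ Suc n) f 0 / fact (Suc n)"
    unfolding der g(3) by (simp add: divide_simps del: of_nat_Suc)
  moreover have "\<forall>z\<in>S. f z = z ^ Suc n * g z"
    using g(2) by (subst eq) auto
  ultimately show ?case using g(1) by blast
qed

section \<open>The tangent on a vertical strip\<close>

text \<open>
  The common term is \<open>(sinh (Im z))\<^sup>2\<close>. That it is the same for cosine and sine lets the modulus
  of \<open>tan z\<close> be compared with \<open>tan (Re z)\<close>.
\<close>

lemma norm_cos_sin_squared: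
  obtains q where "q \<ge> 0" "norm (cos z) ^ 2 = cos (Re z) ^ 2 + q"
    "norm (sin z) ^ 2 = sin (Re z) ^ 2 + q"
proof
  define q where "q = (exp (Im z) - inverse (exp (Im z))) ^ 2 / 4"
  show "q \<ge> 0" "norm (cos z) ^ 2 = cos (Re z) ^ 2 + q"
    by (auto simp: q_def norm_cos_squared)
  show "norm (sin z) ^ 2 = sin (Re z) ^ 2 + q"
    unfolding q_def norm_sin_squared cos_double_sin exp_double power2_diff
    by (simp add: power_inverse)
qed

lemma sin_squared_less_cos_squared:
  fixes x :: real
  assumes "\<bar>x\<bar> < pi / 4"
  shows "sin x ^ 2 < cos x ^ 2"
proof -
  have "cos (2 * x) > 0" using assms by (intro cos_gt_zero_pi) auto
  then show ?thesis by (simp add: cos_double)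
qed

lemma cos_nonzero_on_strip:
  fixes z :: complex
  assumes "\<bar>Re z\<bar> < pi / 4"
  shows "cos z \<noteq> 0"
proof -
  obtain q where "q \<ge> 0" "norm (cos z) ^ 2 = cos (Re z) ^ 2 + q"
    by (rule norm_cos_sin_squared)
  then have "norm (cos z) ^ 2 > 0"
    using sin_squared_less_cos_squared[OF assms] by (smt (verit) zero_le_power2)
  then show ?thesis by auto
qed

lemma norm_tan_strip_less_1:
  fixes z :: complex
  assumes "\<bar>Re z\<bar> < pi / 4"
  shows "norm (tan z) < 1"
proof -
  obtain q where "q \<ge> 0" "norm (cos z) ^ 2 = cos (Re z) ^ 2 + q"
    "norm (sin z) ^ 2 = sin (Re z) ^ 2 + q"
    by (rule norm_cos_sin_squared)
  then have "norm (sin z) ^ 2 < norm (cos z) ^ 2"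
    using sin_squared_less_cos_squared[OF assms] by simp
  then have "norm (sin z) < norm (cos z)" by (rule power2_less_imp_less) simp
  then show ?thesis
    using cos_nonzero_on_strip[OF assms] by (simp add: tan_def norm_divide)
qed

text \<open>
  The square of \<open>norm (tan z)\<close> arises from \<open>(tan (Re z))\<^sup>2 \<le> 1\<close> when the same nonnegative term is
  added to numerator and denominator, and that moves a fraction towards \<open>1\<close>.
\<close>

lemma tan_Re_le_norm_tan:
  fixes z :: complex
  assumes "\<bar>Re z\<bar> < pi / 4"
  shows "tan (Re z) \<le> norm (tan z)"
proof -
  obtain q where q: "q \<ge> 0" "norm (cos z) ^ 2 = cos (Re z) ^ 2 + q"
    "norm (sin z) ^ 2 = sin (Re z) ^ 2 + q"
    by (rule norm_cos_sin_squared)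
  define s c where "s = sin (Re z) ^ 2" and "c = cos (Re z) ^ 2"
  have sc: "0 \<le> s" "s < c"
    using sin_squared_less_cos_squared[OF assms] by (auto simp: s_def c_def)
  then have "q * s \<le> q * c" using q(1) by (intro mult_left_mono) auto
  then have "s / c \<le> (s + q) / (c + q)"
    using sc q(1) by (simp add: divide_simps algebra_simps)
  then have "tan (Re z) ^ 2 \<le> norm (tan z) ^ 2"
    using q by (simp add: tan_def norm_divide power_divide s_def c_def)
  then show ?thesis by (rule power2_le_imp_le) simp
qed

text \<open>
  Writing \<open>tan z = z * t z\<close> transfers the factor \<open>z ^ n\<close> and the leading coefficient from a function
  to its tangent without higher derivatives of a composition.
\<close>

lemma tan_factor_strip:
  defines "S \<equiv> {z. \<bar>Re z\<bar> < pi / 4}"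
  obtains t where "t holomorphic_on S" "t 0 = (1::complex)" "\<And>z. tan z = z * t z"
proof
  define t where "t = (\<lambda>z::complex. if z = 0 then deriv tan 0 else (tan z - tan 0) / (z - 0))"
  have "(tan has_field_derivative inverse (cos 0 ^ 2)) (at (0::complex))"
    by (rule DERIV_tan) simp
  then have d: "deriv tan (0::complex) = 1" using DERIV_imp_deriv by fastforce
  have "open S"
  proof -
    have "S = Re -` {-(pi/4)<..<pi/4}" by (auto simp: S_def abs_less_iff)
    then show ?thesis by (auto intro!: open_vimage continuous_intros)
  qed
  moreover have "tan holomorphic_on S"
    unfolding holomorphic_on_def
    using cos_nonzero_on_strip DERIV_tan
    by (auto simp: S_def field_differentiable_def intro: DERIV_subset)
  ultimately show "t holomorphic_on S"
    unfolding t_def by (intro pole_lemma_open)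
  show "t 0 = 1" by (simp add: t_def d)
  show "tan z = z * t z" for z by (simp add: t_def)
qed

section \<open>Harmonic functions with a multiple zero\<close>

text \<open>
  The constant \<open>c\<close> may exceed \<open>pi / 4 * norm (f 0)\<close> because \<open>(r + c) / (1 + c * r)\<close> is increasing
  in \<open>c\<close> for \<open>r < 1\<close>. This is used to replace the modulus of a sum of two coefficients by the sum
  of their moduli.
\<close>

lemma tan_Re_growth:
  assumes hol: "f holomorphic_on ball 0 1"
    and bound: "\<And>z. norm z < 1 \<Longrightarrow> \<bar>Re (z ^ n * f z)\<bar> < 1"
    and c: "pi / 4 * norm (f 0) \<le> c"
    and n: "n \<ge> 1" and z: "norm z < 1"
  shows "tan (pi / 4 * Re (z ^ n * f z)) \<le> norm z ^ n * (norm z + c) / (1 + c * norm z)"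
proof -
  define F where "F = (\<lambda>z. of_real (pi / 4) * (z ^ n * f z))"
  have strip: "\<bar>Re (F x)\<bar> < pi / 4" if "norm x < 1" for x
  proof -
    have "Re (F x) = pi / 4 * Re (x ^ n * f x)" by (simp add: F_def right_diff_distrib) 
    then have "\<bar>Re (F x)\<bar> = pi / 4 * \<bar>Re (x ^ n * f x)\<bar>" by (simp only: abs_mult) simp
    then show ?thesis using bound[OF that] by (simp del: times_complex.sel)
  qed
  obtain t where t: "t holomorphic_on {z. \<bar>Re z\<bar> < pi / 4}" "t 0 = (1::complex)"
      "\<And>z. tan z = z * t z"
    by (rule tan_factor_strip) blast
  define \<psi> where "\<psi> = (\<lambda>z. of_real (pi / 4) * f z * t (F z))"
  have holF: "F holomorphic_on ball 0 1" unfolding F_def by (intro holomorphic_intros hol)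
  have "F ` ball 0 1 \<subseteq> {z. \<bar>Re z\<bar> < pi / 4}" using strip by auto
  then have "(\<lambda>z. t (F z)) holomorphic_on ball 0 1"
    using holomorphic_on_compose_gen[OF holF t(1)] by (simp add: o_def)
  then have hol\<psi>: "\<psi> holomorphic_on ball 0 1"
    unfolding \<psi>_def by (intro holomorphic_intros hol)
  have tan_eq: "tan (F z) = z ^ n * \<psi> z" for z
    by (simp add: t(3)[of "F z"] \<psi>_def) (simp add: F_def)
  have le1: "norm (\<psi> x) \<le> 1" if "norm x < 1" for x
  proof (rule bounded_by_one_of_power_mult[OF hol\<psi> _ that])
    show "norm (y ^ n * \<psi> y) \<le> 1" if "norm y < 1" for y
      using norm_tan_strip_less_1[OF strip[OF that]] by (simp add: tan_eq)
  qed
  have "F 0 = 0" using n by (simp add: F_def)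
  then have \<psi>0: "norm (\<psi> 0) \<le> c"
    using c by (simp add: \<psi>_def t(2) norm_mult)
  have "norm (\<psi> z) \<le> (norm z + norm (\<psi> 0)) / (1 + norm (\<psi> 0) * norm z)"
    by (rule schwarz_pick_growth[OF hol\<psi> le1 z])
  also have "\<dots> \<le> (norm z + c) / (1 + c * norm z)"
  proof -
    \<comment> \<open>after clearing denominators the difference of the two sides is this product\<close>
    have "(c - norm (\<psi> 0)) * (1 - norm z ^ 2) \<ge> 0"
      using \<psi>0 z by (simp add: power_le_one)
    moreover have "1 + norm (\<psi> 0) * norm z > 0" "1 + c * norm z > 0"
      using \<psi>0 by (smt (verit) mult_nonneg_nonneg norm_ge_zero)+
    ultimately show ?thesis
      by (simp add: divide_simps) (simp add: algebra_simps power2_eq_square)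
  qed
  finally have "norm (\<psi> z) \<le> (norm z + c) / (1 + c * norm z)" .
  then have "norm z ^ n * norm (\<psi> z) \<le> norm z ^ n * ((norm z + c) / (1 + c * norm z))"
    by (intro mult_left_mono) auto
  moreover have "tan (Re (F z)) \<le> norm z ^ n * norm (\<psi> z)"
    using tan_Re_le_norm_tan[OF strip[OF z]] by (simp add: tan_eq norm_mult norm_power)
  moreover have "Re (F z) = pi / 4 * Re (z ^ n * f z)" by (simp add: F_def right_diff_distrib)
  ultimately show ?thesis by simp
qed

text \<open>
  Where \<open>deriv h\<close> does not vanish the equation is the definition of the dilatation. Those points
  form a nonempty open set, so the identity theorem extends it to the zeros of \<open>deriv h\<close>.
\<close>

lemma sense_preserving_dilatation:
  assumes dec: "harmonic_decomposition w h g S"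
    and sp: "sense_preserving_on w S"
    and S: "open S" "connected S"
  obtains \<omega> where "\<omega> holomorphic_on S" "\<And>z. z \<in> S \<Longrightarrow> deriv g z = \<omega> z * deriv h z"
proof -
  note W = harmonic_decomposition_wirtinger[OF dec S(1)]
  note hg = dec[unfolded harmonic_decomposition_def]
  obtain z0 \<omega> where z0: "z0 \<in> S" "wirtinger_z w z0 \<noteq> 0" and \<omega>: "\<omega> holomorphic_on S"
    "\<And>z. z \<in> S \<Longrightarrow> wirtinger_z w z \<noteq> 0 \<Longrightarrow> \<omega> z = second_dilatation w z"
    using sp unfolding sense_preserving_on_def by blast
  have hol: "deriv g holomorphic_on S" "(\<lambda>z. \<omega> z * deriv h z) holomorphic_on S"
    using hg S(1) \<omega>(1) by (auto intro!: holomorphic_intros holomorphic_deriv)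
  define U where "U = {z \<in> S. deriv h z \<noteq> 0}"
  have "open U"
  proof -
    have "continuous_on S (deriv h)"
      using hg S(1) by (auto intro!: holomorphic_on_imp_continuous_on holomorphic_deriv)
    then have "open (S \<inter> deriv h -` (- {0}))"
      using S(1) by (auto simp: continuous_on_open_vimage Int_commute)
    then show ?thesis by (simp add: U_def Int_def)
  qed
  have on_U: "deriv g z = \<omega> z * deriv h z" if "z \<in> U" for z
    using \<omega>(2)[of z] W[of z] that by (auto simp: U_def second_dilatation_def)
  have "z0 \<in> U" using z0 W(1) by (simp add: U_def)
  have "deriv g z = \<omega> z * deriv h z" if "z \<in> S" for z
    using analytic_continuation_open[of U S "deriv g" "\<lambda>z. \<omega> z * deriv h z"]
      \<open>open U\<close> \<open>z0 \<in> U\<close> S hol on_U that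
    by (auto simp: U_def)
  with \<omega>(1) show ?thesis by (rule that)
qed

text \<open>
  The order of the zero refers to some decomposition \<open>h1 + cnj g1\<close> with normalised constants, but
  \<open>deriv h = wirtinger_z w = deriv h1\<close>, so the derivatives of \<open>h\<close> of positive order vanish along with
  those of \<open>h1\<close>. Leibniz' rule for \<open>deriv g = \<omega> * deriv h\<close> passes this on to \<open>g\<close>.
\<close>

lemma sum_higher_derivs_zero:
  assumes dec: "harmonic_decomposition w h g S"
    and sp: "sense_preserving_on w S"
    and zero: "harmonic_zero_order w S 0 p"
    and S: "open S" "connected S" "0 \<in> S"
    and k: "0 < k" "k < p"
  shows "(deriv ^^ k) (\<lambda>z. h z + g z) 0 = 0"
proof -
  obtain j where j: "k = Suc j" using k(1) gr0_implies_Suc by blast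
  note hg = dec[unfolded harmonic_decomposition_def]
  obtain h1 g1 where h1: "harmonic_decomposition w h1 g1 S"
     "\<And>k. k < p \<Longrightarrow> (deriv ^^ k) h1 0 = 0"
    using zero unfolding harmonic_zero_order_def by (auto simp: divide_eq_0_iff)
  have hol_dh: "deriv h holomorphic_on S" "deriv h1 holomorphic_on S" "deriv g holomorphic_on S"
    using hg h1(1) S(1) by (auto simp: harmonic_decomposition_def intro: holomorphic_deriv)
  have dh: "(deriv ^^ i) (deriv h) 0 = 0" if "Suc i < p" for i
  proof -
    have "(deriv ^^ i) (deriv h) 0 = (deriv ^^ i) (deriv h1) 0"
    proof (rule higher_deriv_transform_within_open[OF hol_dh(1,2) S(1,3)])
      show "deriv h z = deriv h1 z" if "z \<in> S" for z
        using harmonic_decomposition_wirtinger(1)[OF dec S(1) that]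
          harmonic_decomposition_wirtinger(1)[OF h1(1) S(1) that] by simp
    qed
    also have "\<dots> = (deriv ^^ Suc i) h1 0" by (simp only: funpow_Suc_right o_def)
    finally show ?thesis using h1(2)[OF that] by simp
  qed
  obtain \<omega> where \<omega>: "\<omega> holomorphic_on S" "\<And>z. z \<in> S \<Longrightarrow> deriv g z = \<omega> z * deriv h z"
    by (rule sense_preserving_dilatation[OF dec sp S(1,2)]) blast
  have "(deriv ^^ j) (deriv g) 0 = (deriv ^^ j) (\<lambda>z. \<omega> z * deriv h z) 0"
    by (rule higher_deriv_transform_within_open[OF hol_dh(3) _ S(1,3) \<omega>(2)])
       (intro holomorphic_intros \<omega>(1) hol_dh)
  also have "\<dots> = (\<Sum>i = 0..j. of_nat (j choose i) * (deriv ^^ i) \<omega> 0 * (deriv ^^ (j - i)) (deriv h) 0)"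
    by (rule higher_deriv_mult[OF \<omega>(1) hol_dh(1) S(1,3)])
  also have "\<dots> = 0"
    \<comment> \<open>only derivatives of \<open>deriv h\<close> of order at most \<open>j < p - 1\<close> occur\<close>
    using k j dh by (intro sum.neutral) auto
  finally have "(deriv ^^ k) g 0 = 0" by (simp only: j funpow_Suc_right o_def)
  moreover have "(deriv ^^ k) h 0 = 0"
    using dh[of j] k j by (simp only: funpow_Suc_right o_def)
  ultimately show ?thesis
    using higher_deriv_add[of h S g 0 k] hg S by simp
qed

section \<open>Comparison of boundary derivatives\<close>

lemma has_real_derivative_nonpos_of_left_min:
  fixes f :: "real \<Rightarrow> real"
  assumes der: "(f has_real_derivative L) (at b within {a<..<b})"
    and "a < b" and ge: "\<And>x. a < x \<Longrightarrow> x < b \<Longrightarrow> f b \<le> f x"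
  shows "L \<le> 0"
proof (rule tendsto_upperbound)
  show "((\<lambda>x. (f x - f b) / (x - b)) \<longlongrightarrow> L) (at b within {a<..<b})"
    using der by (simp add: has_field_derivative_iff)
  show "\<forall>\<^sub>F x in at b within {a<..<b}. (f x - f b) / (x - b) \<le> 0"
    unfolding eventually_at_filter
    using ge by (intro always_eventually) (auto intro!: divide_nonneg_neg)
  have "b islimpt {a<..<b}" using \<open>a < b\<close> by (simp add: islimpt_greaterThanLessThan2)
  then show "at b within {a<..<b} \<noteq> bot" by (simp add: trivial_limit_within)
qed

lemma boundary_radial_derivative:
  assumes "has_boundary_wirtinger w A B (ball 0 1) 1"
  shows "((\<lambda>r. Re (w (of_real r))) has_real_derivative Re (A + B)) (at 1 within {0<..<1})"
proof -
  have "(w has_derivative (\<lambda>t. A * t + B * cnj t)) (at (of_real 1) within (of_real ` {0<..<1}))"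
    using assms unfolding has_boundary_wirtinger_def
    by (rule_tac has_derivative_subset) auto
  then have "((\<lambda>r. w (of_real r)) has_derivative (\<lambda>t. A * of_real t + B * cnj (of_real t)))
      (at 1 within {0<..<1})"
    by (rule has_derivative_in_compose[rotated]) (auto intro!: derivative_eq_intros)
  from has_derivative_Re[OF this] show ?thesis
    by (rule has_derivative_imp_has_field_derivative) (simp add: algebra_simps)
qed

theorem theorem1p1:
  fixes w h g :: "complex \<Rightarrow> complex" and p :: nat and A B a b :: complex
  assumes "p \<ge> 1"
    and "harmonic_map_on w (ball 0 1)"
    and "harmonic_decomposition w h g (ball 0 1)"
    and "sense_preserving_on w (ball 0 1)"
    and "harmonic_zero_order w (ball 0 1) 0 p"
    and "w ` ball 0 1 \<subseteq> ball 0 1"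
    and "a = (deriv ^^ p) h 0 / fact p"
    and "b = (deriv ^^ p) g 0 / fact p"
    and "w 1 = 1"
    and "has_boundary_wirtinger w A B (ball 0 1) 1"
  shows "Re (A + B) \<ge>
           2 / pi * (((real p + 1) + pi / 4 * (real p - 1) * (norm a + norm b)) /
                     (1 + pi / 4 * (norm a + norm b)))"
proof -
  note hg = assms(3)[unfolded harmonic_decomposition_def]
  define c where "c = pi / 4 * (norm a + norm b)"
  have c0: "c \<ge> 0" by (simp add: c_def)
  define k where "k = - (h 0 + g 0)"
  define F where "F = (\<lambda>z. (h z + g z) + k)"
  have hol: "(\<lambda>z. h z + g z) holomorphic_on ball 0 1" "F holomorphic_on ball 0 1"
    using hg unfolding F_def by (auto intro!: holomorphic_intros)
  have derF: "(deriv ^^ i) F 0 = (deriv ^^ i) (\<lambda>z. h z + g z) 0" if "i > 0" for i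
    unfolding F_def using that
    by (subst higher_deriv_add[OF hol(1), of _ 0]) auto
  \<comment> \<open>the constant \<open>k\<close> makes the derivative of order \<open>0\<close> vanish as well\<close>
  have F_zero: "(deriv ^^ i) F 0 = 0" if "i < p" for i
  proof (cases "i = 0")
    case True
    then show ?thesis by (simp add: F_def k_def)
  next
    case False
    then show ?thesis
      using derF sum_higher_derivs_zero[OF assms(3-5)] that by simp
  qed
  have F_lead: "(deriv ^^ p) F 0 / fact p = a + b"
    using derF[of p] higher_deriv_add[of h "ball 0 1" g 0 p] hg assms(1)
    by (simp add: assms(7,8) add_divide_distrib)
  obtain f where f: "f holomorphic_on ball 0 1" "\<And>z. z \<in> ball 0 1 \<Longrightarrow> F z = z ^ p * f z"
    "f 0 = a + b"
    using holomorphic_factor_power[OF hol(2), of p] F_zero F_lead by fastforce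
  have "w 0 = 0" using assms(5) by (simp add: harmonic_zero_order_def)
  then have "h 0 + cnj (g 0) = 0" using hg by simp
  then have "Re (h 0 + cnj (g 0)) = 0" by (simp only: zero_complex.sel)
  then have "Re k = 0" by (simp add: k_def)
  then have Re_eq: "Re (z ^ p * f z) = Re (w z)" if "norm z < 1" for z
  proof -
    have "Re (F z) = Re (w z)" using \<open>Re k = 0\<close> that hg by (simp add: F_def)
    then show ?thesis using f(2)[of z] that by simp
  qed
  have Re_w: "\<bar>Re (w z)\<bar> < 1" if "norm z < 1" for z
    using assms(6) that abs_Re_le_cmod[of "w z"] by fastforce
  have growth: "tan (pi / 4 * Re (w (of_real r))) \<le> r ^ p * (r + c) / (1 + c * r)"
    if r: "0 < r" "r < 1" for r :: real
  proof -
    have "pi / 4 * norm (f 0) \<le> c"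
      unfolding f(3) c_def by (intro mult_left_mono norm_triangle_ineq) auto
    from tan_Re_growth[OF f(1) _ this assms(1), of "of_real r"] show ?thesis
      using r Re_eq[of "of_real r"] Re_eq Re_w by simp
  qed
  define D where "D = (\<lambda>r. r ^ p * (r + c) / (1 + c * r) - tan (pi / 4 * Re (w (of_real r))))"
  have D1: "D 1 = 0"
    using c0 assms(9) by (simp add: D_def tan_45 add.commute add_nonneg_eq_0_iff)
  define L where "L = ((real p + 1) + (real p - 1) * c) / (1 + c) - pi / 2 * Re (A + B)"
  have "(D has_real_derivative L) (at 1 within {0<..<1})"
  proof -
    have G: "((\<lambda>r. r ^ p * (r + c) / (1 + c * r)) has_real_derivative
        ((real p + 1) + (real p - 1) * c) / (1 + c)) (at 1 within {0<..<1})"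
      using c0
      by (auto intro!: derivative_eq_intros simp: add_nonneg_eq_0_iff)
         (simp add: divide_simps, simp add: algebra_simps)
    have T: "(tan has_real_derivative 2) (at (pi / 4 * Re (w (of_real 1))))"
    proof -
      have "(tan has_real_derivative inverse (cos (pi / 4) ^ 2)) (at (pi / 4))"
        by (rule DERIV_tan) (simp add: cos_45)
      then show ?thesis using assms(9) by (simp add: cos_45 power_divide)
    qed
    have "((\<lambda>r. tan (pi / 4 * Re (w (of_real r)))) has_real_derivative
        2 * (pi / 4 * Re (A + B))) (at 1 within {0<..<1})"
      by (rule DERIV_chain2[OF T DERIV_cmult[OF boundary_radial_derivative[OF assms(10)]]])
    from DERIV_diff[OF G this] show ?thesis by (simp add: D_def L_def)
  qed
  then have "L \<le> 0"
    by (rule has_real_derivative_nonpos_of_left_min) (use growth D1 in \<open>auto simp: D_def\<close>)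
  then have "((real p + 1) + (real p - 1) * c) / (1 + c) \<le> pi / 2 * Re (A + B)"
    by (simp only: L_def diff_le_0_iff_le)
  then have "2 / pi * (((real p + 1) + (real p - 1) * c) / (1 + c)) \<le> 2 / pi * (pi / 2 * Re (A + B))"
    by (intro mult_left_mono) auto
  also have "\<dots> = Re (A + B)" by simp
  finally show ?thesis by (simp only: c_def mult_ac)
qed

end
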